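(* Let $n>3$, let $(a;\,b)=(a_1,\ldots,a_{n-2};\,b_1,\ldots,b_{n-2})\in\mathbb{Z}^{2n-4}\setminus\{0\}$ be the Dynnikov coordinates of an integral lamination $\mathcal{L}$ in the $n$-punctured disk $D_n$, and write $M=\sum_{i=1}^{n-2}(|a_i|+|b_i|)$. Then applying the component-counting algorithm described in the context (Steps 1--5) to $\mathcal{L}$ (that is, to $(a;\,b)$) requires $O(n^2M)$ arithmetic operations, each carried out on a pair of integers of sizes (absolute values) $O(n^2M^2)$.
   Context: **Integral laminations.** For $n\ge 3$, $D_n$ is a standard $n$-punctured disk in the plane, with punctures $1,\ldots,n$ arranged from left to right along the horizontal diameter. A simple closed curve in $D_n$ is inessential if it bounds an unpunctured, a once-punctured, or an $n$-punctured disk, and is essential otherwise. An integral lamination $\mathcal{L}$ in $D_n$ is a non-empty (finite) union of pairwise disjoint unoriented essential simple closed curves in $D_n$, up to isotopy; $\mathcal{L}_n$ is the set of these. **Dynnikov coordinates.** The Dynnikov arcs are: for $1\le i\le n-2$, $\alpha_{2i-1}$ (resp. $\alpha_{2i}$) is the vertical arc joining puncture $i+1$ to the boundary of the disk above (resp. below) it; for $1\le i\le n-1$, $\beta_i$ is the vertical arc, with both endpoints on the boundary, passing between punctures $i$ and $i+1$. A minimal representative of $\mathcal{L}$ is a representative intersecting each of these arcs minimally. Write $\alpha_i$, $\beta_i$ also for the number of intersections of a minimal representative with the corresponding arcs. The Dynnikov coordinates of $\mathcal{L}$ are $\rho(\mathcal{L})=(a_1,\ldots,a_{n-2};\,b_1,\ldots,b_{n-2})$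 with $a_i=(\alpha_{2i}-\alpha_{2i-1})/2$ and $b_i=(\beta_i-\beta_{i+1})/2$. The map $\rho:\mathcal{L}_n\to\mathbb{Z}^{2n-4}\setminus\{0\}$ is a bijection. **Cost model.** An arithmetic operation means adding, subtracting, comparing, taking the maximum, or taking the minimum of two integers. The evaluation of the greatest common divisor in Step 5 is counted as $O(\log(n^2M^2))$ arithmetic operations. The constants implied by $O(\cdot)$ are absolute (independent of $n$ and of $\mathcal{L}$). **Notation.** $x^+=\max(x,0)$. The gcd is non-negative, with $\gcd(0,c)=|c|$. For $(a;\,b)=(a_0,\ldots,a_{m-1};\,b_0,\ldots,b_{m-1})\in\mathbb{Z}^{2m}$ write $n(a;\,b)=m$, and if all $b_j\neq 0$ write $i(a;\,b)$ for the smallest $i\in\{1,\ldots,m-1\}$ with $b_i>0$ (all vectors arising in the algorithm satisfy $a_0=a_{m-1}=0$, $b_0\le 0$, $b_{m-1}\ge 0$, so this exists). **The algorithm.** It computes the number of connected components of $\mathcal{L}$, and works with pairs $((a;\,b),Y)$, where $Y$ is a non-negative integer. *Step 1.* Replace the input $(a;\,b)\in\mathbb{Z}^{2n-4}$ with $(a_0,\ldots,a_{n-1};\,b_0,\ldots,b_{n-1})\in\mathbb{Z}^{2n}$, where $a_0=a_{n-1}=0$, $b_0=-\max_{1\le k\le n-2}\left(|a_k|+b_k^++\sum_{j=1}^{k-1}b_j\right)$, $b_{n-1}=-b_0-\sum_{j=1}^{n-2}b_j$. Set $Y=0$ and go to Step 2. *Step 2.* If $b_i=0$ for some $i$, let $(a';\,b')$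 be obtained from $(a;\,b)$ by erasing the coordinates $a_i$ and $b_i$ (and re-indexing the later ones by shifting down by 1). If $n(a';\,b')=3$ input $((a';\,b'),Y)$ to Step 5; if $n(a';\,b')>3$ input $((a';\,b'),Y)$ to Step 2. Otherwise (no $b_i=0$) input $((a;\,b),Y)$ to Step 3. *Step 3.* Let $i=i(a;\,b)$. If $a_{i-1}=a_i$, let $N=\min(-b_{i-1},b_i)$, $a'=a$, $b'_{i-1}=b_{i-1}+N$, $b'_i=b_i-N$, $b'_j=b_j$ for $j\ne i-1,i$, and input $((a';\,b'),Y+N)$ to Step 2. Otherwise input $((a;\,b),Y)$ to Step 4. *Step 4.* With $i=i(a;\,b)$ (and $a_{i-1}\ne a_i$), let $a'_j=a_j$, $b'_j=b_j$ for $j\ne i-1,i$, and: - Case Ia) $0<a_{i-1}-a_i$ and $b_i-b_{i-1}\le a_{i-1}-a_i$: $a'_{i-1}=a_i-b_{i-1}$, $a'_i=a_{i-1}-b_i$, $b'_{i-1}=b_i$, $b'_i=b_{i-1}$. - Case Ib) $0<a_{i-1}-a_i<b_i-b_{i-1}$: $a'_{i-1}=\min(a_i-b_{i-1},a_{i-1})$, $a'_i=\max(a_{i-1}-b_i,a_i)$, $b'_{i-1}=b_{i-1}+(a_{i-1}-a_i)$, $b'_i=b_i-(a_{i-1}-a_i)$. - Case IIa) $0<a_i-a_{i-1}$ and $b_i-b_{i-1}\le a_i-a_{i-1}$: $a'_{i-1}=a_i+b_{i-1}$, $a'_i=a_{i-1}+b_i$, $b'_{i-1}=b_i$, $b'_i=b_{i-1}$.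 - Case IIb) $0<a_i-a_{i-1}<b_i-b_{i-1}$: $a'_{i-1}=\max(a_{i-1},a_i+b_{i-1})$, $a'_i=\min(a_i,a_{i-1}+b_i)$, $b'_{i-1}=b_{i-1}+(a_i-a_{i-1})$, $b'_i=b_i-(a_i-a_{i-1})$. Input $((a';\,b'),Y)$ to Step 3 in cases Ia) and IIa), and to Step 2 in cases Ib) and IIb). *Step 5.* Now $(a;\,b)=(0,a_1,0;\,b_0,b_1,b_2)$. Output $\gcd(a_1,b_1)+Y+\min(-b_0,\,b_2,\,-|a_1|-b_0-b_1^+)$. *)

theory Defs
  imports "HOL-Analysis.Analysis"
begin

section \<open>Integral laminations in the punctured disk\<close>

definition disk :: "complex set" where
  "disk = cball 0 1"

definition puncture :: "nat \<Rightarrow> nat \<Rightarrow> complex" where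
  "puncture n i = complex_of_real (-1 + 2 * real i / (real n + 1))"

definition punctures :: "nat \<Rightarrow> complex set" where
  "punctures n = puncture n ` {1..n}"

text \<open>Curves are taken in the interior of the disk, so that isotopic curves are
  ambient isotopic.\<close>

definition simple_closed_curve :: "nat \<Rightarrow> complex set \<Rightarrow> bool" where
  "simple_closed_curve n c \<longleftrightarrow>
     (\<exists>g. simple_path g \<and> pathfinish g = pathstart g \<and> path_image g = c) \<and>
     c \<subseteq> interior disk - punctures n"

definition bounds_disk :: "complex set \<Rightarrow> complex set \<Rightarrow> bool" where
  "bounds_disk c E \<longleftrightarrow> E \<subseteq> disk \<and> E homeomorphic (cball 0 1 :: complex set) \<and> frontier E = c"

definition inessential :: "nat \<Rightarrow> complex set \<Rightarrow> bool" where
  "inessential n c \<longleftrightarrow> (\<exists>E. bounds_disk c E \<and> card (E \<inter> punctures n) \<in> {0, 1, n})"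

definition multicurve :: "nat \<Rightarrow> complex set \<Rightarrow> bool" where
  "multicurve n S \<longleftrightarrow>
     (\<exists>\<C>. finite \<C> \<and> \<C> \<noteq> {} \<and> pairwise disjnt \<C> \<and> S = \<Union>\<C> \<and>
          (\<forall>c\<in>\<C>. simple_closed_curve n c \<and> \<not> inessential n c))"

definition isotopic :: "nat \<Rightarrow> complex set \<Rightarrow> complex set \<Rightarrow> bool" where
  "isotopic n S T \<longleftrightarrow>
     (\<exists>f. homotopic_with_canon
            (\<lambda>h. (\<exists>h'. homeomorphism disk disk h h') \<and> (\<forall>p\<in>punctures n. h p = p))
            disk disk id f \<and> f ` S = T)"

text \<open>A lamination is an isotopy class of multicurves.\<close>

definition integral_laminations :: "nat \<Rightarrow> complex set set set" where
  "integral_laminations n =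
     {S. multicurve n S} // {(S, T). multicurve n S \<and> multicurve n T \<and> isotopic n S T}"

section \<open>Dynnikov coordinates\<close>

text \<open>For \<open>1 \<le> i \<le> n - 2\<close>, \<open>alpha_arc n (2 * i - 1)\<close> and \<open>alpha_arc n (2 * i)\<close> join
  puncture \<open>i + 1\<close> to the boundary above and below it, respectively.\<close>

definition alpha_arc :: "nat \<Rightarrow> nat \<Rightarrow> complex set" where
  "alpha_arc n j =
     {z \<in> disk. Re z = Re (puncture n ((j + 1) div 2 + 1)) \<and>
                (if odd j then Im z \<ge> 0 else Im z \<le> 0)}"

definition beta_arc :: "nat \<Rightarrow> nat \<Rightarrow> complex set" where
  "beta_arc n i = {z \<in> disk. Re z = (Re (puncture n i) + Re (puncture n (i + 1))) / 2}"

definition dynnikov_arcs :: "nat \<Rightarrow> complex set set" where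
  "dynnikov_arcs n = alpha_arc n ` {1..2 * n - 4} \<union> beta_arc n ` {1..n - 1}"

definition minimal_representative :: "nat \<Rightarrow> complex set set \<Rightarrow> complex set \<Rightarrow> bool" where
  "minimal_representative n L S \<longleftrightarrow> S \<in> L \<and>
     (\<forall>A\<in>dynnikov_arcs n. finite (S \<inter> A) \<and>
        (\<forall>T\<in>L. finite (T \<inter> A) \<longrightarrow> card (S \<inter> A) \<le> card (T \<inter> A)))"

text \<open>The lists hold \<open>a\<^sub>1, \<dots>, a\<^sub>n\<^sub>-\<^sub>2\<close> and \<open>b\<^sub>1, \<dots>, b\<^sub>n\<^sub>-\<^sub>2\<close>, so the
  coordinate with index \<open>i\<close> sits at list position \<open>i - 1\<close>.\<close>

definition dynnikov_coordinates :: "nat \<Rightarrow> complex set set \<Rightarrow> int list \<Rightarrow> int list \<Rightarrow> bool" where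
  "dynnikov_coordinates n L a b \<longleftrightarrow>
     length a = n - 2 \<and> length b = n - 2 \<and>
     (\<exists>S. minimal_representative n L S \<and>
        (\<forall>i\<in>{1..n - 2}.
           real_of_int (a ! (i - 1)) =
             (real (card (S \<inter> alpha_arc n (2 * i))) - real (card (S \<inter> alpha_arc n (2 * i - 1)))) / 2 \<and>
           real_of_int (b ! (i - 1)) =
             (real (card (S \<inter> beta_arc n i)) - real (card (S \<inter> beta_arc n (i + 1)))) / 2))"

section \<open>Cost model\<close>

text \<open>Quantities computed by the algorithm are written as expressions, which determine both
  the value and the operations (with their operands) carried out to obtain it.  Negation and
  absolute value are composed from the admitted operations.\<close>

datatype expr =
    Lit int
  | AddE expr expr
  | SubE expr expr
  | MaxE expr expr
  | MinE expr expr
  | GcdE expr expr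

datatype event = Arith_Op int int | Gcd_Op int int

fun val :: "expr \<Rightarrow> int" where
  "val (Lit x) = x"
| "val (AddE e f) = val e + val f"
| "val (SubE e f) = val e - val f"
| "val (MaxE e f) = max (val e) (val f)"
| "val (MinE e f) = min (val e) (val f)"
| "val (GcdE e f) = gcd (val e) (val f)"

fun ops :: "expr \<Rightarrow> event list" where
  "ops (Lit x) = []"
| "ops (AddE e f) = ops e @ ops f @ [Arith_Op (val e) (val f)]"
| "ops (SubE e f) = ops e @ ops f @ [Arith_Op (val e) (val f)]"
| "ops (MaxE e f) = ops e @ ops f @ [Arith_Op (val e) (val f)]"
| "ops (MinE e f) = ops e @ ops f @ [Arith_Op (val e) (val f)]"
| "ops (GcdE e f) = ops e @ ops f @ [Gcd_Op (val e) (val f)]"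

definition compare_ops :: "expr \<Rightarrow> expr \<Rightarrow> event list" where
  "compare_ops e f = ops e @ ops f @ [Arith_Op (val e) (val f)]"

definition NegE :: "expr \<Rightarrow> expr" where
  "NegE e = SubE (Lit 0) e"

definition AbsE :: "int \<Rightarrow> expr" where
  "AbsE x = MaxE (Lit x) (NegE (Lit x))"

definition PosE :: "int \<Rightarrow> expr" where
  "PosE x = MaxE (Lit x) (Lit 0)"

definition SumE :: "int list \<Rightarrow> expr" where
  "SumE xs = foldr (\<lambda>x e. AddE (Lit x) e) xs (Lit 0)"

definition MaximumE :: "expr list \<Rightarrow> expr" where
  "MaximumE es = foldr MaxE (butlast es) (last es)"

text \<open>\<open>g\<close> is the number of arithmetic operations charged for a gcd.\<close>

fun event_cost :: "nat \<Rightarrow> event \<Rightarrow> nat" where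
  "event_cost g (Arith_Op x y) = 1"
| "event_cost g (Gcd_Op x y) = g"

definition op_count :: "nat \<Rightarrow> event list \<Rightarrow> nat" where
  "op_count g t = sum_list (map (event_cost g) t)"

fun event_operands :: "event \<Rightarrow> int set" where
  "event_operands (Arith_Op x y) = {x, y}"
| "event_operands (Gcd_Op x y) = {x, y}"

definition operands :: "event list \<Rightarrow> int set" where
  "operands t = (\<Union>e\<in>set t. event_operands e)"

section \<open>The algorithm\<close>

text \<open>\<open>Step1\<close> holds the input vector, \<open>Step2\<close> to \<open>Step5\<close> hold the pair of the current vector
  (indexed from 0) and \<open>Y\<close>.\<close>

datatype config =
    Step1 "int list" "int list"
  | Step2 "int list" "int list" int
  | Step3 "int list" "int list" int
  | Step4 "int list" "int list" int
  | Step5 "int list" "int list" int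
  | Output int

definition erase :: "nat \<Rightarrow> 'a list \<Rightarrow> 'a list" where
  "erase i xs = take i xs @ drop (Suc i) xs"

definition first_pos :: "int list \<Rightarrow> nat \<Rightarrow> bool" where
  "first_pos b i \<longleftrightarrow> 1 \<le> i \<and> i < length b \<and> b ! i > 0 \<and> (\<forall>j\<in>{1..<i}. \<not> b ! j > 0)"

definition first_pos_ops :: "int list \<Rightarrow> nat \<Rightarrow> event list" where
  "first_pos_ops b i = concat (map (\<lambda>j. compare_ops (Lit (b ! j)) (Lit 0)) [1..<Suc i])"

definition zero_test_ops :: "int list \<Rightarrow> event list" where
  "zero_test_ops b = concat (map (\<lambda>x. compare_ops (Lit x) (Lit 0)) b)"

definition replace_pair :: "nat \<Rightarrow> expr \<Rightarrow> expr \<Rightarrow> int list \<Rightarrow> int list" where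
  "replace_pair i e f xs = xs[i - 1 := val e, i := val f]"

text \<open>\<open>p, q, r, s\<close> stand for \<open>a\<^sub>i\<^sub>-\<^sub>1, a\<^sub>i, b\<^sub>i\<^sub>-\<^sub>1, b\<^sub>i\<close>.  All case distinctions are charged,
  whichever case applies.\<close>

definition case_test_ops :: "int \<Rightarrow> int \<Rightarrow> int \<Rightarrow> int \<Rightarrow> event list" where
  "case_test_ops p q r s =
     compare_ops (Lit 0) (SubE (Lit p) (Lit q)) @
     compare_ops (SubE (Lit s) (Lit r)) (SubE (Lit p) (Lit q)) @
     compare_ops (Lit 0) (SubE (Lit q) (Lit p)) @
     compare_ops (SubE (Lit s) (Lit r)) (SubE (Lit q) (Lit p))"

text \<open>\<open>peak_expr a b k\<close> denotes \<open>|a\<^sub>k| + b\<^sub>k\<^sup>+ + (b\<^sub>1 + \<dots> + b\<^sub>k\<^sub>-\<^sub>1)\<close>, where the input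
  lists start at index 1.\<close>

definition peak_expr :: "int list \<Rightarrow> int list \<Rightarrow> nat \<Rightarrow> expr" where
  "peak_expr a b k =
     AddE (AddE (AbsE (a ! (k - 1))) (PosE (b ! (k - 1)))) (SumE (take (k - 1) b))"

text \<open>\<open>step c t c'\<close>: one step leads from \<open>c\<close> to \<open>c'\<close> and performs the operations \<open>t\<close>.  The
  choice of the erased index in Step 2 is left open, so the relation is not deterministic.\<close>

inductive step :: "config \<Rightarrow> event list \<Rightarrow> config \<Rightarrow> bool" where
  step1:
    "\<lbrakk> e = NegE (MaximumE (map (peak_expr a b) [1..<Suc (length a)]));
       f = SubE (NegE (Lit (val e))) (SumE b) \<rbrakk> \<Longrightarrow>
     step (Step1 a b) (ops e @ ops f) (Step2 (0 # a @ [0]) (val e # b @ [val f]) 0)"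
| step2_erase_last:
    "\<lbrakk> i < length b; b ! i = 0; a' = erase i a; b' = erase i b; length a' = 3 \<rbrakk> \<Longrightarrow>
     step (Step2 a b Y) (zero_test_ops b @ compare_ops (Lit (int (length a'))) (Lit 3)) (Step5 a' b' Y)"
| step2_erase:
    "\<lbrakk> i < length b; b ! i = 0; a' = erase i a; b' = erase i b; length a' > 3 \<rbrakk> \<Longrightarrow>
     step (Step2 a b Y) (zero_test_ops b @ compare_ops (Lit (int (length a'))) (Lit 3)) (Step2 a' b' Y)"
| step2_nonzero:
    "\<forall>i<length b. b ! i \<noteq> 0 \<Longrightarrow>
     step (Step2 a b Y) (zero_test_ops b) (Step3 a b Y)"
| step3_eq:
    "\<lbrakk> first_pos b i; p = a ! (i - 1); q = a ! i; r = b ! (i - 1); s = b ! i; p = q;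
       N = MinE (NegE (Lit r)) (Lit s);
       r' = AddE (Lit r) (Lit (val N)); s' = SubE (Lit s) (Lit (val N));
       Y' = AddE (Lit Y) (Lit (val N)) \<rbrakk> \<Longrightarrow>
     step (Step3 a b Y)
       (first_pos_ops b i @ compare_ops (Lit p) (Lit q) @ ops N @ ops r' @ ops s' @ ops Y')
       (Step2 a (replace_pair i r' s' b) (val Y'))"
| step3_neq:
    "\<lbrakk> first_pos b i; p = a ! (i - 1); q = a ! i; p \<noteq> q \<rbrakk> \<Longrightarrow>
     step (Step3 a b Y) (first_pos_ops b i @ compare_ops (Lit p) (Lit q)) (Step4 a b Y)"
| step4_Ia:
    "\<lbrakk> first_pos b i; p = a ! (i - 1); q = a ! i; r = b ! (i - 1); s = b ! i;
       0 < p - q; s - r \<le> p - q;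
       p' = SubE (Lit q) (Lit r); q' = SubE (Lit p) (Lit s); r' = Lit s; s' = Lit r \<rbrakk> \<Longrightarrow>
     step (Step4 a b Y)
       (first_pos_ops b i @ case_test_ops p q r s @ ops p' @ ops q' @ ops r' @ ops s')
       (Step3 (replace_pair i p' q' a) (replace_pair i r' s' b) Y)"
| step4_Ib:
    "\<lbrakk> first_pos b i; p = a ! (i - 1); q = a ! i; r = b ! (i - 1); s = b ! i;
       0 < p - q; p - q < s - r;
       p' = MinE (SubE (Lit q) (Lit r)) (Lit p); q' = MaxE (SubE (Lit p) (Lit s)) (Lit q);
       r' = AddE (Lit r) (SubE (Lit p) (Lit q)); s' = SubE (Lit s) (SubE (Lit p) (Lit q)) \<rbrakk> \<Longrightarrow>
     step (Step4 a b Y)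
       (first_pos_ops b i @ case_test_ops p q r s @ ops p' @ ops q' @ ops r' @ ops s')
       (Step2 (replace_pair i p' q' a) (replace_pair i r' s' b) Y)"
| step4_IIa:
    "\<lbrakk> first_pos b i; p = a ! (i - 1); q = a ! i; r = b ! (i - 1); s = b ! i;
       0 < q - p; s - r \<le> q - p;
       p' = AddE (Lit q) (Lit r); q' = AddE (Lit p) (Lit s); r' = Lit s; s' = Lit r \<rbrakk> \<Longrightarrow>
     step (Step4 a b Y)
       (first_pos_ops b i @ case_test_ops p q r s @ ops p' @ ops q' @ ops r' @ ops s')
       (Step3 (replace_pair i p' q' a) (replace_pair i r' s' b) Y)"
| step4_IIb:
    "\<lbrakk> first_pos b i; p = a ! (i - 1); q = a ! i; r = b ! (i - 1); s = b ! i;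
       0 < q - p; q - p < s - r;
       p' = MaxE (Lit p) (AddE (Lit q) (Lit r)); q' = MinE (Lit q) (AddE (Lit p) (Lit s));
       r' = AddE (Lit r) (SubE (Lit q) (Lit p)); s' = SubE (Lit s) (SubE (Lit q) (Lit p)) \<rbrakk> \<Longrightarrow>
     step (Step4 a b Y)
       (first_pos_ops b i @ case_test_ops p q r s @ ops p' @ ops q' @ ops r' @ ops s')
       (Step2 (replace_pair i p' q' a) (replace_pair i r' s' b) Y)"
| step5:
    "\<lbrakk> e = AddE (AddE (GcdE (Lit a1) (Lit b1)) (Lit Y))
             (MinE (MinE (NegE (Lit b0)) (Lit b2))
                   (SubE (SubE (NegE (AbsE a1)) (Lit b0)) (PosE b1))) \<rbrakk> \<Longrightarrow>
     step (Step5 [0, a1, 0] [b0, b1, b2] Y) (ops e) (Output (val e))"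

text \<open>\<open>run c t c'\<close>: finitely many steps lead from \<open>c\<close> to \<open>c'\<close>, performing in total the
  operations \<open>t\<close>.\<close>

inductive run :: "config \<Rightarrow> event list \<Rightarrow> config \<Rightarrow> bool" where
  run_refl: "run c [] c"
| run_step: "\<lbrakk> step c t c'; run c' u c'' \<rbrakk> \<Longrightarrow> run c (t @ u) c''"

text \<open>\<open>halts c\<close>: every execution from \<open>c\<close> reaches an output after finitely many steps;
  in particular it neither gets stuck nor continues forever.\<close>

inductive halts :: "config \<Rightarrow> bool" where
  halts_output: "halts (Output N)"
| halts_step: "\<lbrakk> \<exists>t c'. step c t c'; \<forall>t c'. step c t c' \<longrightarrow> halts c' \<rbrakk> \<Longrightarrow> halts c"

end

(* The partial sums h_k = -(b_0 + ... + b_(k-1)) of a vector satisfy |a_k| <= h_k and |a_k| <= h_(k+1)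
   after Step 1, and every later step preserves these inequalities.  Erasing a zero b_i drops a repeated
   h_i.  Steps 3 and 4 only change h_i, where i = i(a; b), and lower it by the positive amount N,
   b_i - b_(i-1) or |a_(i-1) - a_i|.  Hence all h_k stay in [0, 2M], which bounds the numbers that occur,
   and the sum of the h_k, initially at most 2nM, bounds the number of passes through Steps 3 and 4 and
   the growth of Y.  A step costs O(n) operations. *)

theory Submission
  imports Defs
begin

text \<open>When no \<open>b_j\<close> vanishes, \<open>i(a; b)\<close> marks the first strict local
  maximum of the heights, so Steps 3 and 4 cut down a peak. The danger is cutting below 0, which
  \<open>b\<close> alone does not exclude: in Cases Ia and IIa the new height is
  \<open>h_(i-1) + h_(i+1) - h_i\<close>. The inequalities on \<open>a\<close> supply what is
  missing: \<open>|a_(i-1) - a_i|\<close> is at most \<open>h_(i-1) + h_(i+1)\<close>, and with the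
  case conditions this keeps the new height nonnegative. The bound \<open>2M\<close> arises because
  an initial height is 0 or \<open>-b_0\<close>, at most \<open>M\<close>, minus a partial sum of
  the input \<open>b\<close>, again at most \<open>M\<close> in absolute value. The erased index is
  a free choice, so a rank is shown to fall at every possible step; it bounds the length of all runs
  and yields termination. The single gcd costs \<open>O(log(nM))\<close> operations, which
  \<open>n^2 M\<close> absorbs.\<close>

text \<open>After Step 1 these are half the intersection numbers \<open>\<beta>\<^sub>k\<close>.\<close>

definition height :: "int list \<Rightarrow> nat \<Rightarrow> int" where
  "height b k = - sum_list (take k b)"

definition potential :: "int list \<Rightarrow> int" where
  "potential b = (\<Sum>k<length b. height b k)"

text \<open>Geometrically, the strands that pass the puncture of index \<open>k\<close> from one
  side to the other number twice the smaller adjacent height, and \<open>a_k\<close> is half the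
  difference between those passing below and above it; hence the two inequalities.\<close>

definition balanced :: "int \<Rightarrow> int list \<Rightarrow> int list \<Rightarrow> bool" where
  "balanced W a b \<longleftrightarrow> length a = length b \<and> height b (length b) = 0 \<and>
     (\<forall>k<length b. \<bar>a ! k\<bar> \<le> height b k \<and> \<bar>a ! k\<bar> \<le> height b (Suc k) \<and> height b k \<le> W)"

section \<open>Heights under transfer between neighbouring entries and under erasure\<close>

lemma height_0 [simp]: "height b 0 = 0"
  by (simp add: height_def)

lemma height_Suc: "k < length b \<Longrightarrow> height b (Suc k) = height b k - b ! k"
  by (simp add: height_def take_Suc_conv_app_nth)

text \<open>Shorter prefixes contain neither changed entry and longer ones contain both, so only one
  partial sum moves. All changes of \<open>b\<close> in Steps 3 and 4 have this form, even the swap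
  in Cases Ia and IIa, where \<open>d = b_i - b_(i-1)\<close>.\<close>

lemma height_transfer:
  assumes "1 \<le> i" "i < length b" "k \<le> length b"
  shows "height (b[i - 1 := b ! (i - 1) + d, i := b ! i - d]) k = height b k - (if k = i then d else 0)"
  using assms(3)
proof (induction k)
  case 0
  then show ?case using assms by simp
next
  case (Suc k)
  then show ?case using assms
    by (auto simp: height_Suc nth_list_update)
qed

lemma length_erase [simp]: "i < length xs \<Longrightarrow> length (erase i xs) = length xs - 1"
  by (simp add: erase_def)

lemma nth_erase:
  "\<lbrakk> i < length xs; k < length xs - 1 \<rbrakk> \<Longrightarrow> erase i xs ! k = xs ! (if k < i then k else Suc k)"
  by (auto simp: erase_def nth_append min_def)

lemma height_erase:
  assumes "i < length b" "b ! i = 0" "k < length b"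
  shows "height (erase i b) k = height b (if k < i then k else Suc k)"
  using assms(3)
proof (induction k)
  case 0
  then show ?case using assms by (auto simp: height_Suc)
next
  case (Suc k)
  have "height (erase i b) (Suc k) = height (erase i b) k - erase i b ! k"
    using Suc.prems assms by (intro height_Suc) simp
  also have "\<dots> = height b (if k < i then k else Suc k) - b ! (if k < i then k else Suc k)"
    using Suc assms by (simp add: nth_erase)
  also have "\<dots> = height b (if Suc k < i then Suc k else Suc (Suc k))"
    using Suc.prems assms height_Suc[of k b] height_Suc[of "Suc k" b]
    by (cases "Suc k = i") auto
  finally show ?case .
qed

section \<open>Balanced vectors: bounds, erasure and transfer\<close>

lemma height_nonneg:
  assumes "balanced W a b" "k \<le> length b"
  shows "0 \<le> height b k"
  using assms unfolding balanced_def by (cases "k < length b") (force, simp)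

lemma potential_nonneg: "balanced W a b \<Longrightarrow> 0 \<le> potential b"
  unfolding potential_def by (intro sum_nonneg height_nonneg) auto

lemma potential_le:
  assumes "balanced W a b"
  shows "potential b \<le> int (length b) * W"
  using sum_bounded_above[of "{..<length b}" "height b" W] assms
  by (simp add: potential_def balanced_def)

lemma balanced_bound_nonneg: "balanced W a b \<Longrightarrow> b \<noteq> [] \<Longrightarrow> 0 \<le> W"
  unfolding balanced_def using height_0 by (metis length_greater_0_conv)

lemma balanced_abs_le:
  assumes "balanced W a b" "k < length b"
  shows "\<bar>a ! k\<bar> \<le> W" and "\<bar>b ! k\<bar> \<le> W"
proof -
  have W: "0 \<le> W" using balanced_bound_nonneg assms by force
  show "\<bar>a ! k\<bar> \<le> W" using assms unfolding balanced_def by force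
  have "height b (Suc k) \<le> W"
    using assms W unfolding balanced_def by (cases "Suc k = length b") auto
  then show "\<bar>b ! k\<bar> \<le> W"
    using height_Suc[of k b] height_nonneg[of W a b k] height_nonneg[of W a b "Suc k"] assms
    unfolding balanced_def by fastforce
qed

text \<open>Erasing index \<open>i\<close> leaves the entries \<open>i - 1\<close> and
  \<open>i + 1\<close> on the two sides of one height, the common value
  \<open>h_i = h_(i+1)\<close>, so no inequality is lost.\<close>

lemma balanced_erase:
  assumes "balanced W a b" "i < length b" "b ! i = 0"
  shows "balanced W (erase i a) (erase i b)"
proof -
  have len: "length a = length b" using assms by (simp add: balanced_def)
  have h: "height (erase i b) k = height b (if k < i then k else Suc k)" if "k < length b" for k
    using height_erase assms that by blast
  obtain m where m: "length b = Suc m" using assms by (cases b) auto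
  have "height (erase i b) (length (erase i b)) = 0"
    using assms h[of m] height_Suc[of i b] m unfolding balanced_def
    by (cases "i = m") auto
  moreover have "\<bar>erase i a ! k\<bar> \<le> height (erase i b) k \<and>
      \<bar>erase i a ! k\<bar> \<le> height (erase i b) (Suc k) \<and> height (erase i b) k \<le> W"
    if "k < length b - 1" for k
  proof -
    have "\<bar>a ! j\<bar> \<le> height b j \<and> \<bar>a ! j\<bar> \<le> height b (Suc j) \<and> height b j \<le> W"
      if "j < length b" for j
      using assms that by (simp add: balanced_def)
    note this[of k] this[of "Suc k"]
    then show ?thesis
      using that assms h[of k] h[of "Suc k"] height_Suc[of i b] len
      by (cases "Suc k = i") (auto simp: nth_erase)
  qed
  ultimately show ?thesis using assms len by (auto simp: balanced_def)
qed

lemma potential_erase: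
  assumes "balanced W a b" "i < length b" "b ! i = 0"
  shows "potential (erase i b) \<le> potential b"
proof -
  let ?f = "\<lambda>k. if k < i then k else Suc k"
  have "potential (erase i b) = (\<Sum>k<length b - 1. height b (?f k))"
    unfolding potential_def using assms by (intro sum.cong) (auto simp: height_erase)
  also have "\<dots> = sum (height b) (?f ` {..<length b - 1})"
    by (subst sum.reindex) (auto simp: inj_on_def split: if_splits)
  also have "\<dots> \<le> potential b"
    unfolding potential_def using assms height_nonneg[OF assms(1)] by (intro sum_mono2) auto
  finally show ?thesis .
qed

text \<open>Lowering \<open>h_i\<close> can only endanger the inequalities for the entries on its
  two sides, at \<open>i - 1\<close> and \<open>i\<close>. With arbitrary new values
  \<open>p\<close> and \<open>q\<close> there, one lemma serves Step 3 and all cases of Step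
  4.\<close>

lemma balanced_transfer:
  assumes bal: "balanced W a b" and i: "1 \<le> i" "i < length b" and d: "0 \<le> d"
    and p: "\<bar>p\<bar> \<le> height b (i - 1)" "\<bar>p\<bar> \<le> height b i - d"
    and q: "\<bar>q\<bar> \<le> height b i - d" "\<bar>q\<bar> \<le> height b (Suc i)"
  defines "a' \<equiv> a[i - 1 := p, i := q]"
    and "b' \<equiv> b[i - 1 := b ! (i - 1) + d, i := b ! i - d]"
  shows "balanced W a' b'" and "potential b' = potential b - d"
proof -
  have h: "height b' k = height b k - (if k = i then d else 0)" if "k \<le> length b" for k
    unfolding b'_def using height_transfer i that by blast
  have len: "length b' = length b" "length a' = length b" using bal by (auto simp: a'_def b'_def balanced_def)
  have *: "\<bar>a ! k\<bar> \<le> height b k \<and> \<bar>a ! k\<bar> \<le> height b (Suc k) \<and> height b k \<le> W"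
    if "k < length b" for k
    using bal that by (simp add: balanced_def)
  have "\<bar>a' ! k\<bar> \<le> height b' k \<and> \<bar>a' ! k\<bar> \<le> height b' (Suc k) \<and> height b' k \<le> W"
    if k: "k < length b" for k
  proof -
    consider "k = i" | "Suc k = i" | "k \<noteq> i" "Suc k \<noteq> i" by blast
    then show ?thesis
    proof cases
      case 1
      then show ?thesis using k q d *[OF k] h[of k] h[of "Suc k"] bal i
        by (auto simp: a'_def balanced_def)
    next
      case 2
      then show ?thesis using k p d *[OF k] h[of k] h[of "Suc k"] bal i
        by (auto simp: a'_def balanced_def)
    next
      case 3
      then show ?thesis using k *[OF k] h[of k] h[of "Suc k"] bal i
        by (auto simp: a'_def balanced_def nth_list_update)
    qed
  qed
  then show "balanced W a' b'" using len bal h[of "length b"] i by (auto simp: balanced_def)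
  have "potential b' = (\<Sum>k<length b. height b k - (if k = i then d else 0))"
    unfolding potential_def len by (intro sum.cong) (auto simp: h)
  then show "potential b' = potential b - d"
    using i by (simp add: potential_def sum_subtractf)
qed

section \<open>Operation counts and operands of compound expressions\<close>

lemma op_count_simps [simp]:
  "op_count g [] = 0"
  "op_count g (e # t) = event_cost g e + op_count g t"
  "op_count g (t @ u) = op_count g t + op_count g u"
  by (auto simp: op_count_def)

lemma operands_simps [simp]:
  "operands [] = {}"
  "operands (e # t) = event_operands e \<union> operands t"
  "operands (t @ u) = operands t \<union> operands u"
  by (auto simp: operands_def)

lemma op_count_first_pos_ops [simp]: "op_count g (first_pos_ops b i) = i"
  by (induction i) (auto simp: first_pos_ops_def compare_ops_def)

lemma operands_first_pos_ops: "operands (first_pos_ops b i) \<subseteq> (!) b ` {1..i} \<union> {0}"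
  by (auto simp: first_pos_ops_def compare_ops_def operands_def)

lemma op_count_zero_test_ops [simp]: "op_count g (zero_test_ops b) = length b"
  by (induction b) (auto simp: zero_test_ops_def compare_ops_def)

lemma operands_zero_test_ops: "operands (zero_test_ops b) \<subseteq> set b \<union> {0}"
  by (auto simp: zero_test_ops_def compare_ops_def operands_def)

lemma val_SumE [simp]: "val (SumE xs) = sum_list xs"
  by (induction xs) (auto simp: SumE_def)

lemma op_count_SumE [simp]: "op_count g (ops (SumE xs)) = length xs"
  by (induction xs) (auto simp: SumE_def)

lemma operands_SumE: "x \<in> operands (ops (SumE xs)) \<Longrightarrow> \<bar>x\<bar> \<le> sum_list (map abs xs)"
proof (induction xs)
  case Nil
  then show ?case by (simp add: SumE_def)
next
  case (Cons y ys)
  have S: "SumE (y # ys) = AddE (Lit y) (SumE ys)" by (simp add: SumE_def)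
  have "\<bar>sum_list ys\<bar> \<le> sum_list (map abs ys)" "0 \<le> sum_list (map abs ys)"
    by (rule sum_list_abs, rule sum_list_nonneg) auto
  then show ?case using Cons by (auto simp: S)
qed

lemma MaximumE_Cons: "es \<noteq> [] \<Longrightarrow> MaximumE (e # es) = MaxE e (MaximumE es)"
  by (simp add: MaximumE_def)

lemma MaximumE_single [simp]: "MaximumE [e] = e"
  by (simp add: MaximumE_def)

lemma val_MaximumE:
  assumes "es \<noteq> []"
  shows "val (MaximumE es) = Max (val ` set es)"
  using assms by (induction es rule: list_nonempty_induct) (auto simp: MaximumE_Cons)

lemma op_count_MaximumE:
  assumes "es \<noteq> []" "\<forall>e\<in>set es. op_count g (ops e) \<le> c"
  shows "op_count g (ops (MaximumE es)) \<le> length es * Suc c"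
  using assms by (induction es rule: list_nonempty_induct) (auto simp: MaximumE_Cons)

lemma operands_MaximumE:
  assumes "es \<noteq> []" "\<forall>e\<in>set es. \<bar>val e\<bar> \<le> B \<and> (\<forall>x\<in>operands (ops e). \<bar>x\<bar> \<le> B)"
  shows "\<bar>val (MaximumE es)\<bar> \<le> B \<and> (\<forall>x\<in>operands (ops (MaximumE es)). \<bar>x\<bar> \<le> B)"
  using assms by (induction es rule: list_nonempty_induct) (auto simp: MaximumE_Cons max_def)

text \<open>Step 1 is excluded because raw coordinates need not be balanced; it is treated
  separately. The bound on \<open>Y + potential b\<close> persists because Step 3 adds to
  \<open>Y\<close> exactly what it takes from the potential. The further conjuncts for Steps 3 and 4
  record tests already passed, so that a first positive index exists and some case of Step 4
  applies.\<close>

fun invariant :: "nat \<Rightarrow> int \<Rightarrow> config \<Rightarrow> bool" where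
  "invariant n W (Step1 a b) \<longleftrightarrow> False"
| "invariant n W (Step2 a b Y) \<longleftrightarrow> balanced W a b \<and> 3 < length b \<and> length b \<le> n \<and>
     0 \<le> Y \<and> Y + potential b \<le> int n * W"
| "invariant n W (Step3 a b Y) \<longleftrightarrow> balanced W a b \<and> 3 < length b \<and> length b \<le> n \<and>
     0 \<le> Y \<and> Y + potential b \<le> int n * W \<and> (\<forall>j<length b. b ! j \<noteq> 0)"
| "invariant n W (Step4 a b Y) \<longleftrightarrow> balanced W a b \<and> 3 < length b \<and> length b \<le> n \<and>
     0 \<le> Y \<and> Y + potential b \<le> int n * W \<and> (\<forall>j<length b. b ! j \<noteq> 0) \<and>
     (\<forall>i. first_pos b i \<longrightarrow> a ! (i - 1) \<noteq> a ! i)"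
| "invariant n W (Step5 a b Y) \<longleftrightarrow> balanced W a b \<and> length b = 3 \<and>
     0 \<le> Y \<and> Y + potential b \<le> int n * W"
| "invariant n W (Output N) \<longleftrightarrow> True"

text \<open>The factor 3 pays for the return from Step 4 to Step 2, where the potential drops by at least 1.\<close>

fun config_rank :: "config \<Rightarrow> nat" where
  "config_rank (Step1 a b) = 0"
| "config_rank (Step2 a b Y) = 3 * nat (potential b) + length b + 3"
| "config_rank (Step3 a b Y) = 3 * nat (potential b) + length b + 2"
| "config_rank (Step4 a b Y) = 3 * nat (potential b) + length b + 1"
| "config_rank (Step5 a b Y) = 1"
| "config_rank (Output N) = 0"

text \<open>The gcd is evaluated only once, so its cost is kept apart from the uniform cost of a step.\<close>

fun pending_gcd :: "nat \<Rightarrow> config \<Rightarrow> nat" where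
  "pending_gcd g (Output N) = 0"
| "pending_gcd g c = g"

section \<open>The first peak of the heights\<close>

lemma first_pos_exists:
  assumes bal: "balanced W a b" and nz: "\<forall>j<length b. b ! j \<noteq> 0" and "b \<noteq> []"
  shows "\<exists>i. first_pos b i"
proof -
  have "\<exists>i. 1 \<le> i \<and> i < length b \<and> b ! i > 0"
  proof (rule ccontr)
    assume "\<not> ?thesis"
    then have neg: "b ! j < 0" if "1 \<le> j" "j < length b" for j
      using nz that by (metis linorder_neqE_linordered_idom)
    \<comment> \<open>Index 0 is not covered by \<open>neg\<close>, but \<open>b ! 0\<close> is
      minus the height \<open>h_1\<close>. With all entries negative, the last height could not be
      0.\<close>
    have "b ! 0 < 0"
      using height_nonneg[OF bal, of 1] height_Suc[of 0 b] nz assms(3)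
      by (cases "b ! 0 = 0") (auto simp: Suc_le_eq)
    then have "b ! j < 0" if "j < length b" for j using neg[of j] that by (cases j) auto
    then have "(\<Sum>j\<in>{0..<length b}. b ! j) < (\<Sum>j\<in>{0..<length b}. 0)"
      using assms(3) by (intro sum_strict_mono) auto
    then have "sum_list b < 0" by (simp add: sum_list_sum_nth)
    then show False using bal by (simp add: balanced_def height_def)
  qed
  then have "\<exists>i. (1 \<le> i \<and> i < length b \<and> b ! i > 0) \<and> (\<forall>j<i. \<not> (1 \<le> j \<and> j < length b \<and> b ! j > 0))"
    by (rule exists_least_iff[THEN iffD1])
  then show ?thesis unfolding first_pos_def by force
qed

lemma first_pos_unique: "\<lbrakk> first_pos b i; first_pos b j \<rbrakk> \<Longrightarrow> i = j"
  unfolding first_pos_def by (metis atLeastLessThan_iff linorder_neqE_nat)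

text \<open>Minimality of \<open>i\<close> and the absence of zeros make \<open>b ! (i - 1)\<close>
  negative; for \<open>i = 1\<close>, which minimality does not reach, the reason is
  \<open>b ! 0 = - height b 1\<close>. The two equations then exhibit \<open>height b i\<close> as a
  strict local maximum.\<close>

lemma first_pos_local:
  assumes bal: "balanced W a b" and nz: "\<forall>j<length b. b ! j \<noteq> 0" and fp: "first_pos b i"
  shows "b ! (i - 1) < 0" "0 < b ! i"
    "\<bar>a ! (i - 1)\<bar> \<le> height b (i - 1)" "\<bar>a ! i\<bar> \<le> height b (Suc i)"
    "height b (i - 1) = height b i + b ! (i - 1)" "height b (Suc i) = height b i - b ! i"
proof -
  have i: "1 \<le> i" "i < length b" "0 < b ! i" and ni: "\<forall>j\<in>{1..<i}. \<not> 0 < b ! j"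
    using fp by (auto simp: first_pos_def)
  show "0 < b ! i" by fact
  show "height b (i - 1) = height b i + b ! (i - 1)" "height b (Suc i) = height b i - b ! i"
    using height_Suc[of "i - 1" b] height_Suc[of i b] i by auto
  show "\<bar>a ! (i - 1)\<bar> \<le> height b (i - 1)" "\<bar>a ! i\<bar> \<le> height b (Suc i)"
    using bal i by (auto simp: balanced_def)
  show "b ! (i - 1) < 0"
  proof (cases "i = 1")
    case True
    then show ?thesis using height_nonneg[OF bal, of 1] height_Suc[of 0 b] i nz
      by (metis One_nat_def diff_self_eq_0 diff_0 height_0 i(2) less_imp_le
          neg_0_le_iff_le order_less_le order_less_trans zero_less_one)
  next
    case False
    then show ?thesis using ni i nz by (metis One_nat_def atLeastLessThan_iff diff_less
      le_add_diff_inverse less_imp_diff_less less_one linorder_neqE_linordered_idom nat_less_le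
      not_less_eq_eq zero_less_diff)
  qed
qed

text \<open>Here \<open>y\<close> is the growth of \<open>Y\<close>, namely \<open>N\<close> in Step
  3 and 0 in Step 4; \<open>y \<le> d\<close> keeps \<open>Y\<close> plus the potential from
  growing. The conclusion is phrased for Step 2; Cases Ia and IIa, which continue with Step 3, only
  have to add that \<open>b\<close> has no zero.\<close>

lemma invariant_transfer:
  assumes bal: "balanced W a b" and len: "3 < length b" "length b \<le> n"
    and Y: "0 \<le> Y" "Y + potential b \<le> int n * W"
    and i: "1 \<le> i" "i < length b" and d: "0 < d" "0 \<le> y" "y \<le> d"
    and p: "\<bar>val p\<bar> \<le> height b (i - 1)" "\<bar>val p\<bar> \<le> height b i - d"
    and q: "\<bar>val q\<bar> \<le> height b i - d" "\<bar>val q\<bar> \<le> height b (Suc i)"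
    and r: "val r = b ! (i - 1) + d" and s: "val s = b ! i - d"
  shows "invariant n W (Step2 (replace_pair i p q a) (replace_pair i r s b) (Y + y)) \<and>
    nat (potential (replace_pair i r s b)) < nat (potential b)"
proof -
  let ?b = "replace_pair i r s b"
  have bal': "balanced W (replace_pair i p q a) ?b" and pot: "potential ?b = potential b - d"
    using balanced_transfer[OF bal i less_imp_le[OF d(1)] p q] by (simp_all add: replace_pair_def r s)
  have "nat (potential ?b) < nat (potential b)"
    using potential_nonneg[OF bal'] pot d by linarith
  then show ?thesis
    using bal' pot len Y d by (simp add: replace_pair_def)
qed

text \<open>Case Ib: \<open>H\<close> is \<open>h_i\<close>, its neighbours are \<open>H + r\<close>
  and \<open>H - s\<close>, and its new value is \<open>H - (p - q)\<close>. Since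
  \<open>p \<le> H + r\<close> rewrites to \<open>q - r \<le> H - (p - q)\<close>, each argument of
  the minimum meets one upper bound; likewise \<open>- q \<le> H - s\<close> rewrites to
  \<open>- (H - (p - q)) \<le> p - s\<close> for the maximum.\<close>

lemma excess_bounds:
  fixes H p q r s :: int
  assumes "r < 0" "0 < s" "\<bar>p\<bar> \<le> H + r" "\<bar>q\<bar> \<le> H - s" "0 < p - q" "p - q < s - r"
  shows "\<bar>min (q - r) p\<bar> \<le> H + r" "\<bar>min (q - r) p\<bar> \<le> H - (p - q)"
    "\<bar>max (p - s) q\<bar> \<le> H - (p - q)" "\<bar>max (p - s) q\<bar> \<le> H - s"
proof -
  have "p \<le> H + r" "- p \<le> H + r" "q \<le> H - s" "- q \<le> H - s"
    using assms by (simp_all only: abs_le_iff)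
  with assms(1,2,5,6)
  show "\<bar>min (q - r) p\<bar> \<le> H + r" "\<bar>min (q - r) p\<bar> \<le> H - (p - q)"
    "\<bar>max (p - s) q\<bar> \<le> H - (p - q)" "\<bar>max (p - s) q\<bar> \<le> H - s"
    unfolding abs_le_iff min_def max_def by (cases "q - r \<le> p"; cases "p - s \<le> q"; simp only: if_True if_False; linarith)+
qed

text \<open>Case IIb is the image of Case Ib under reflection in the horizontal diameter, which
  negates every \<open>a_k\<close> and exchanges minimum and maximum.\<close>

lemma excess_bounds_mirror:
  fixes H p q r s :: int
  assumes "r < 0" "0 < s" "\<bar>p\<bar> \<le> H + r" "\<bar>q\<bar> \<le> H - s" "0 < q - p" "q - p < s - r"
  shows "\<bar>max p (q + r)\<bar> \<le> H + r" "\<bar>max p (q + r)\<bar> \<le> H - (q - p)"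
    "\<bar>min q (p + s)\<bar> \<le> H - (q - p)" "\<bar>min q (p + s)\<bar> \<le> H - s"
proof -
  have "p \<le> H + r" "- p \<le> H + r" "q \<le> H - s" "- q \<le> H - s"
    using assms by (simp_all only: abs_le_iff)
  with assms(1,2,5,6)
  show "\<bar>max p (q + r)\<bar> \<le> H + r" "\<bar>max p (q + r)\<bar> \<le> H - (q - p)"
    "\<bar>min q (p + s)\<bar> \<le> H - (q - p)" "\<bar>min q (p + s)\<bar> \<le> H - s"
    unfolding abs_le_iff min_def max_def
    by (cases "p \<le> q + r"; cases "q \<le> p + s"; simp only: if_True if_False; linarith)+
qed

section \<open>Preservation of the invariant and descent of the rank\<close>

lemma invariant_step:
  assumes "step c t c'" "invariant n W c"
  shows "invariant n W c' \<and> config_rank c' < config_rank c"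
  using assms
proof (induction rule: step.induct)
  case (step2_erase_last i b a' a b' Y)
  then show ?case using balanced_erase[of W a b i] potential_erase[of W a b i]
    by (auto simp: balanced_def)
next
  case (step2_erase i b a' a b' Y)
  then have bal: "balanced W a b" by simp
  have "nat (potential b') \<le> nat (potential b)"
    using potential_erase[OF bal] step2_erase by (simp add: nat_mono)
  then show ?case
    using step2_erase balanced_erase[OF bal] potential_erase[OF bal, of i] by (auto simp: balanced_def)
next
  case (step3_eq b i p a q r s N r' s' Y' Y)
  then have inv: "balanced W a b" "3 < length b" "length b \<le> n" "0 \<le> Y"
      "Y + potential b \<le> int n * W" and nz: "\<forall>j<length b. b ! j \<noteq> 0"
    by auto
  note loc = first_pos_local[OF inv(1) nz step3_eq(1), folded step3_eq(2-5)]
  have i: "1 \<le> i" "i < length b" using step3_eq(1) by (auto simp: first_pos_def)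
  \<comment> \<open>Replacing entries of \<open>a\<close> by themselves fits Step 3 to
    \<open>invariant_transfer\<close>. The new height is the larger neighbour, and
    \<open>p = q\<close> is bounded by both neighbours.\<close>
  have a: "replace_pair i (Lit p) (Lit q) a = a"
    by (simp only: replace_pair_def val.simps step3_eq(2,3) list_update_id)
  have N: "val N = min (- r) s" using step3_eq by (simp add: NegE_def)
  have *: "invariant n W (Step2 (replace_pair i (Lit p) (Lit q) a) (replace_pair i r' s' b) (Y + val N)) \<and>
      nat (potential (replace_pair i r' s' b)) < nat (potential b)"
    by (rule invariant_transfer[where d = "val N"]; (rule inv i)?;
        use loc N step3_eq(4-6,8,9) in \<open>simp add: abs_le_iff; linarith?\<close>)+
  then show ?case
    using step3_eq(10) unfolding a by (simp add: replace_pair_def del: zless_nat_conj)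
next
  case (step4_Ia b i p a q r s p' q' r' s' Y)
  then have inv: "balanced W a b" "3 < length b" "length b \<le> n" "0 \<le> Y"
      "Y + potential b \<le> int n * W" and nz: "\<forall>j<length b. b ! j \<noteq> 0"
    by auto
  note loc = first_pos_local[OF inv(1) nz step4_Ia(1), folded step4_Ia(2-5)]
  have i: "1 \<le> i" "i < length b" using step4_Ia(1) by (auto simp: first_pos_def)
  \<comment> \<open>A swap is the transfer of \<open>s - r\<close>. The case condition reads
    \<open>q - r \<le> p - s\<close>, and with the bounds on \<open>p\<close> and \<open>q\<close>
    it confines both new entries to the new height \<open>height b i + r - s\<close>.\<close>
  have *: "invariant n W (Step2 (replace_pair i p' q' a) (replace_pair i r' s' b) (Y + 0)) \<and>
      nat (potential (replace_pair i r' s' b)) < nat (potential b)"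
    by (rule invariant_transfer[where d = "s - r"]; (rule inv i)?;
        use loc step4_Ia(4-11) in \<open>simp add: abs_le_iff; linarith?\<close>)+
  \<comment> \<open>Step 3 follows without a new zero test; a swap creates no zero.\<close>
  have "\<forall>j<length b. replace_pair i r' s' b ! j \<noteq> 0"
    using step4_Ia(10,11) loc(1,2) nz i
    by (auto simp: replace_pair_def nth_list_update split: if_splits)
  with * show ?case by (simp add: replace_pair_def del: zless_nat_conj)
next
  case (step4_Ib b i p a q r s p' q' r' s' Y)
  then have inv: "balanced W a b" "3 < length b" "length b \<le> n" "0 \<le> Y"
      "Y + potential b \<le> int n * W" and nz: "\<forall>j<length b. b ! j \<noteq> 0"
    by auto
  note loc = first_pos_local[OF inv(1) nz step4_Ib(1), folded step4_Ib(2-5)]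
  have i: "1 \<le> i" "i < length b" using step4_Ib(1) by (auto simp: first_pos_def)
  note bounds = excess_bounds[OF loc(1,2) loc(3)[unfolded loc(5)] loc(4)[unfolded loc(6)] step4_Ib(6,7),
      folded loc(5,6)]
  have *: "invariant n W (Step2 (replace_pair i p' q' a) (replace_pair i r' s' b) (Y + 0)) \<and>
      nat (potential (replace_pair i r' s' b)) < nat (potential b)"
    using step4_Ib(6) bounds unfolding step4_Ib(8-11)
    by (intro invariant_transfer[where d = "p - q"] inv i) (simp_all add: step4_Ib(4,5))
  from * show ?case by (simp add: replace_pair_def del: zless_nat_conj)
next
  case (step4_IIa b i p a q r s p' q' r' s' Y)
  then have inv: "balanced W a b" "3 < length b" "length b \<le> n" "0 \<le> Y"
      "Y + potential b \<le> int n * W" and nz: "\<forall>j<length b. b ! j \<noteq> 0"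
    by auto
  note loc = first_pos_local[OF inv(1) nz step4_IIa(1), folded step4_IIa(2-5)]
  have i: "1 \<le> i" "i < length b" using step4_IIa(1) by (auto simp: first_pos_def)
  have *: "invariant n W (Step2 (replace_pair i p' q' a) (replace_pair i r' s' b) (Y + 0)) \<and>
      nat (potential (replace_pair i r' s' b)) < nat (potential b)"
    by (rule invariant_transfer[where d = "s - r"]; (rule inv i)?;
        use loc step4_IIa(4-11) in \<open>simp add: abs_le_iff; linarith?\<close>)+
  have "\<forall>j<length b. replace_pair i r' s' b ! j \<noteq> 0"
    using step4_IIa(10,11) loc(1,2) nz i
    by (auto simp: replace_pair_def nth_list_update split: if_splits)
  with * show ?case by (simp add: replace_pair_def del: zless_nat_conj)
next
  case (step4_IIb b i p a q r s p' q' r' s' Y)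
  then have inv: "balanced W a b" "3 < length b" "length b \<le> n" "0 \<le> Y"
      "Y + potential b \<le> int n * W" and nz: "\<forall>j<length b. b ! j \<noteq> 0"
    by auto
  note loc = first_pos_local[OF inv(1) nz step4_IIb(1), folded step4_IIb(2-5)]
  have i: "1 \<le> i" "i < length b" using step4_IIb(1) by (auto simp: first_pos_def)
  note bounds = excess_bounds_mirror[OF loc(1,2) loc(3)[unfolded loc(5)] loc(4)[unfolded loc(6)] step4_IIb(6,7),
      folded loc(5,6)]
  have *: "invariant n W (Step2 (replace_pair i p' q' a) (replace_pair i r' s' b) (Y + 0)) \<and>
      nat (potential (replace_pair i r' s' b)) < nat (potential b)"
    using step4_IIb(6) bounds unfolding step4_IIb(8-11)
    by (intro invariant_transfer[where d = "q - p"] inv i) (simp_all add: step4_IIb(4,5))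
  from * show ?case by (simp add: replace_pair_def del: zless_nat_conj)
next
  case (step3_neq b i p a q Y)
  then have "\<forall>j. first_pos b j \<longrightarrow> a ! (j - 1) \<noteq> a ! j" by (metis first_pos_unique)
  then show ?case using step3_neq(5) by simp
qed auto

section \<open>Cost and operands of a single step\<close>

lemma op_count_step:
  assumes "step c t c'" "invariant n W c"
  shows "op_count g t + pending_gcd g c' \<le> n + 20 + pending_gcd g c"
  using assms(1)
proof (cases rule: step.cases)
  case step1
  then show ?thesis using assms(2) by simp
\<comment> \<open>The longest steps are Cases Ib and IIb: a scan of \<open>i < n\<close> entries, 10
  operations for the case tests and 8 for the new entries. Step 5 takes 11 besides the gcd, whose
  cost is released there by \<open>pending_gcd\<close>.\<close>
qed (use assms(2) in \<open>simp add: compare_ops_def case_test_ops_def NegE_def AbsE_def PosE_def first_pos_def\<close>)+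

lemma gcd_le_abs_add: "gcd x y \<le> \<bar>x\<bar> + \<bar>y\<bar>" for x y :: int
proof (cases "x = 0")
  case False
  then have "gcd x y \<le> \<bar>x\<bar>" using dvd_imp_le_int[of x "gcd x y"] by simp
  then show ?thesis by simp
qed simp

lemma operands_local:
  assumes bal: "balanced W a b" and ne: "b \<noteq> []" and fp: "first_pos b i"
  shows "\<bar>a ! (i - 1)\<bar> \<le> W" "\<bar>a ! i\<bar> \<le> W" "\<bar>b ! (i - 1)\<bar> \<le> W" "\<bar>b ! i\<bar> \<le> W"
    "x \<in> operands (first_pos_ops b i) \<Longrightarrow> \<bar>x\<bar> \<le> W"
proof -
  have i: "1 \<le> i" "i < length b" using fp by (auto simp: first_pos_def)
  then show "\<bar>a ! (i - 1)\<bar> \<le> W" "\<bar>a ! i\<bar> \<le> W" "\<bar>b ! (i - 1)\<bar> \<le> W" "\<bar>b ! i\<bar> \<le> W"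
    using balanced_abs_le[OF bal, of i] balanced_abs_le[OF bal, of "i - 1"] by auto
  assume "x \<in> operands (first_pos_ops b i)"
  then have "x = 0 \<or> (\<exists>j\<le>i. x = b ! j)" 
    by (auto dest!: subsetD[OF operands_first_pos_ops])
  then show "\<bar>x\<bar> \<le> W"
    using balanced_abs_le(2)[OF bal] i balanced_bound_nonneg[OF bal ne] by auto
qed

lemma operands_case_tests:
  assumes "\<bar>p\<bar> \<le> W" "\<bar>q\<bar> \<le> W" "\<bar>r\<bar> \<le> W" "\<bar>s\<bar> \<le> W" "x \<in> operands (case_test_ops p q r s)"
  shows "\<bar>x\<bar> \<le> 2 * W"
  using assms(5)
  by (simp add: case_test_ops_def compare_ops_def; elim disjE; use assms(1-4) in linarith)

text \<open>The term \<open>int n * W\<close> accounts for \<open>Y\<close>, the multiples of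
  \<open>W\<close> for entries, their differences and the gcd, and \<open>int n + 3\<close> for
  comparing the vector length with 3 in Step 2.\<close>

lemma operands_step:
  assumes st: "step c t c'" and inv: "invariant n W c" and x: "x \<in> operands t"
  shows "\<bar>x\<bar> \<le> int n * W + 4 * W + int n + 3"
proof -
  have zero: "\<bar>x\<bar> \<le> W" if "balanced W a b" "b \<noteq> []" "x \<in> operands (zero_test_ops b)" for a b
    using that operands_zero_test_ops[of b] balanced_abs_le(2)[of W a b] balanced_bound_nonneg[of W a b]
    by (fastforce simp: in_set_conv_nth)
  define K where "K = int n * W"
  have bounds: "0 \<le> K" "0 \<le> W" if "balanced W a b" "b \<noteq> []" for a b
    using balanced_bound_nonneg[OF that] by (simp_all add: K_def)
  have "\<bar>x\<bar> \<le> K + 4 * W + int n + 3"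
    using st
  proof (cases rule: step.cases)
    case step1
    then show ?thesis using inv by simp
  next
    case (step2_erase_last i b a' a b' Y)
    then have "balanced W a b" "b \<noteq> []" using inv by auto
    from bounds[OF this] zero[OF this] show ?thesis
      using x step2_erase_last by (auto simp: compare_ops_def)
  next
    case (step2_erase i b a' a b' Y)
    then have bal: "balanced W a b" "b \<noteq> []" using inv by auto
    then have "length a' \<le> n" using inv step2_erase by (auto simp: balanced_def)
    with bounds[OF bal] zero[OF bal] show ?thesis
      using x step2_erase by (auto simp: compare_ops_def)
  next
    case (step2_nonzero b a Y)
    then have "balanced W a b" "b \<noteq> []" using inv by auto
    from bounds[OF this] zero[OF this] show ?thesis using x step2_nonzero by auto
  next
    case (step3_eq b i p a q r s N r' s' Y' Y)
    then have bal: "balanced W a b" "b \<noteq> []" and Y: "0 \<le> Y" "Y + potential b \<le> K"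
      using inv by (auto simp: K_def)
    note loc = operands_local[OF bal step3_eq(4), folded step3_eq(5-8)]
    have "x \<in> operands (first_pos_ops b i) \<or> x \<in> {0, p, q, r, s, - r, Y, min (- r) s}"
      using x step3_eq by (auto simp: compare_ops_def NegE_def)
    then have "\<bar>x\<bar> \<le> W \<or> x \<in> {0, p, q, r, s, - r, Y, min (- r) s}"
      using loc(5) by blast
    then show ?thesis
      using loc(1-4) bounds[OF bal] Y potential_nonneg[OF bal(1)]
      by (elim disjE insertE; simp; linarith?)
  next
    case (step3_neq b i p a q Y)
    then have bal: "balanced W a b" "b \<noteq> []" using inv by auto
    note loc = operands_local[OF bal step3_neq(4), folded step3_neq(5-6)]
    have "x \<in> operands (first_pos_ops b i) \<or> x \<in> {p, q}"
      using x step3_neq by (auto simp: compare_ops_def)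
    then have "\<bar>x\<bar> \<le> W \<or> x \<in> {p, q}"
      using loc(5) by blast
    then show ?thesis using loc(1-4) bounds[OF bal] by (elim disjE insertE; simp; linarith?)
  next
    case (step4_Ia b i p a q r s p' q' r' s' Y)
    then have bal: "balanced W a b" "b \<noteq> []" using inv by auto
    note loc = operands_local[OF bal step4_Ia(4), folded step4_Ia(5-8)]
    have "x \<in> operands (first_pos_ops b i) \<or> x \<in> operands (case_test_ops p q r s) \<or>
        x \<in> {p, q, r, s, p - q, q - r, p - s}"
      using x unfolding step4_Ia by auto
    then have "\<bar>x\<bar> \<le> W \<or> \<bar>x\<bar> \<le> 2 * W \<or> x \<in> {p, q, r, s, p - q, q - r, p - s}"
      using loc(5) operands_case_tests[OF loc(1-4)] by blast
    then show ?thesis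
      using loc(1-4) bounds[OF bal]
      by (elim disjE insertE; simp; linarith?)
  next
    case (step4_Ib b i p a q r s p' q' r' s' Y)
    then have bal: "balanced W a b" "b \<noteq> []" using inv by auto
    note loc = operands_local[OF bal step4_Ib(4), folded step4_Ib(5-8)]
    have "x \<in> operands (first_pos_ops b i) \<or> x \<in> operands (case_test_ops p q r s) \<or>
        x \<in> {p, q, r, s, p - q, q - r, p - s}"
      using x unfolding step4_Ib by auto
    then have "\<bar>x\<bar> \<le> W \<or> \<bar>x\<bar> \<le> 2 * W \<or> x \<in> {p, q, r, s, p - q, q - r, p - s}"
      using loc(5) operands_case_tests[OF loc(1-4)] by blast
    then show ?thesis
      using loc(1-4) bounds[OF bal]
      by (elim disjE insertE; simp; linarith?)
  next
    case (step4_IIa b i p a q r s p' q' r' s' Y)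
    then have bal: "balanced W a b" "b \<noteq> []" using inv by auto
    note loc = operands_local[OF bal step4_IIa(4), folded step4_IIa(5-8)]
    have "x \<in> operands (first_pos_ops b i) \<or> x \<in> operands (case_test_ops p q r s) \<or>
        x \<in> {p, q, r, s, q - p, q + r, p + s}"
      using x unfolding step4_IIa by auto
    then have "\<bar>x\<bar> \<le> W \<or> \<bar>x\<bar> \<le> 2 * W \<or> x \<in> {p, q, r, s, q - p, q + r, p + s}"
      using loc(5) operands_case_tests[OF loc(1-4)] by blast
    then show ?thesis
      using loc(1-4) bounds[OF bal]
      by (elim disjE insertE; simp; linarith?)
  next
    case (step4_IIb b i p a q r s p' q' r' s' Y)
    then have bal: "balanced W a b" "b \<noteq> []" using inv by auto
    note loc = operands_local[OF bal step4_IIb(4), folded step4_IIb(5-8)]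
    have "x \<in> operands (first_pos_ops b i) \<or> x \<in> operands (case_test_ops p q r s) \<or>
        x \<in> {p, q, r, s, q - p, q + r, p + s}"
      using x unfolding step4_IIb by auto
    then have "\<bar>x\<bar> \<le> W \<or> \<bar>x\<bar> \<le> 2 * W \<or> x \<in> {p, q, r, s, q - p, q + r, p + s}"
      using loc(5) operands_case_tests[OF loc(1-4)] by blast
    then show ?thesis
      using loc(1-4) bounds[OF bal]
      by (elim disjE insertE; simp; linarith?)
  next
    case (step5 e a1 b1 Y b0 b2)
    then have bal: "balanced W [0, a1, 0] [b0, b1, b2]" and Y: "0 \<le> Y" "Y + potential [b0, b1, b2] \<le> K"
      using inv by (auto simp: K_def)
    have loc: "\<bar>a1\<bar> \<le> W" "\<bar>b0\<bar> \<le> W" "\<bar>b1\<bar> \<le> W" "\<bar>b2\<bar> \<le> W"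
      using balanced_abs_le[OF bal, of 0] balanced_abs_le[OF bal, of 1] balanced_abs_le[OF bal, of 2]
      by auto
    define u v m G where "u = max a1 (- a1)" and "v = max b1 0" and "m = min (- b0) b2" and "G = gcd a1 b1"
    have aux: "0 \<le> u" "u \<le> W" "0 \<le> v" "v \<le> W" "- W \<le> m" "m \<le> W" "0 \<le> G" "G \<le> 2 * W"
      "0 \<le> Y" "Y \<le> K" "0 \<le> W" "- W \<le> b0" "b0 \<le> W"
    proof -
      have "gcd a1 b1 \<le> 2 * W" using gcd_le_abs_add[of a1 b1] loc(1,3) by linarith
      then show "0 \<le> u" "u \<le> W" "0 \<le> v" "v \<le> W" "- W \<le> m" "m \<le> W" "0 \<le> G" "G \<le> 2 * W"
        "0 \<le> Y" "Y \<le> K" "0 \<le> W" "- W \<le> b0" "b0 \<le> W"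
        using loc bounds[OF bal] Y potential_nonneg[OF bal]
        unfolding u_def v_def m_def G_def by (auto simp: abs_le_iff)
    qed
    have "x \<in> {0, a1, b1, b0, b2, - b0, - a1} \<or> x \<in> {u, - u, v, m, G, Y, G + Y} \<or>
        x \<in> {- u - b0, - u - b0 - v, min m (- u - b0 - v)}"
      using x unfolding step5 u_def v_def m_def G_def by (auto simp: NegE_def AbsE_def PosE_def)
    moreover have "\<bar>x\<bar> \<le> W" if "x \<in> {0, a1, b1, b0, b2, - b0, - a1}"
      using that loc aux(11) by auto
    moreover have "\<bar>x\<bar> \<le> K + 2 * W" if "x \<in> {u, - u, v, m, G, Y, G + Y}"
      using that aux unfolding abs_le_iff by auto
    moreover have "\<bar>x\<bar> \<le> 3 * W" if "x \<in> {- u - b0, - u - b0 - v, min m (- u - b0 - v)}"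
    proof -
      have "- (3 * W) \<le> - u - b0 - v" "- (3 * W) \<le> - u - b0" "- u - b0 \<le> 3 * W" "m \<le> 3 * W"
        "- u - b0 - v \<le> 3 * W" "- (3 * W) \<le> m"
        using aux by linarith+
      with that show ?thesis unfolding abs_le_iff min_def by (auto split: if_splits)
    qed
    ultimately show ?thesis using aux(9-11) by linarith
  qed
  then show ?thesis by (simp add: K_def)
qed

section \<open>Progress, termination and cost of a run\<close>

lemma step_exists:
  assumes "invariant n W c" "\<nexists>N. c = Output N"
  shows "\<exists>t c'. step c t c'"
proof (cases c)
  case (Step2 a b Y)
  show ?thesis
  proof (cases "\<exists>i<length b. b ! i = 0")
    case True
    then obtain i where i: "i < length b" "b ! i = 0" by blast
    have "length (erase i a) = length b - 1" "3 < length b"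
      using i assms Step2 by (auto simp: balanced_def)
    then consider "length (erase i a) = 3" | "length (erase i a) > 3" by linarith
    then show ?thesis unfolding Step2
      using i step2_erase[OF _ _ refl refl] step2_erase_last[OF _ _ refl refl] by cases blast+
  next
    case False
    then show ?thesis unfolding Step2 using step2_nonzero by blast
  qed
next
  case (Step3 a b Y)
  then obtain i where "first_pos b i" using assms first_pos_exists[of W a b] by force
  then show ?thesis unfolding Step3
    using step3_eq[OF _ refl refl refl refl _ refl refl refl refl] step3_neq[OF _ refl refl]
    by (cases "a ! (i - 1) = a ! i") blast+
next
  case (Step4 a b Y)
  then obtain i where i: "first_pos b i" using assms first_pos_exists[of W a b] by force
  let ?p = "a ! (i - 1)" and ?q = "a ! i" and ?d = "b ! i - b ! (i - 1)"
  have "?p \<noteq> ?q" using assms Step4 i by auto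
  then consider "0 < ?p - ?q" "?d \<le> ?p - ?q" | "0 < ?p - ?q" "?p - ?q < ?d"
    | "0 < ?q - ?p" "?d \<le> ?q - ?p" | "0 < ?q - ?p" "?q - ?p < ?d" by linarith
  then show ?thesis
  proof cases
    case 1
    then show ?thesis unfolding Step4
      using step4_Ia[OF i refl refl refl refl _ _ refl refl refl refl] by blast
  next
    case 2
    then show ?thesis unfolding Step4
      using step4_Ib[OF i refl refl refl refl _ _ refl refl refl refl] by blast
  next
    case 3
    then show ?thesis unfolding Step4
      using step4_IIa[OF i refl refl refl refl _ _ refl refl refl refl] by blast
  next
    case 4
    then show ?thesis unfolding Step4
      using step4_IIb[OF i refl refl refl refl _ _ refl refl refl refl] by blast
  qed
next
  case (Step5 a b Y)
  then have bal: "balanced W a b" and len: "length b = 3" "length a = 3"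
    using assms by (auto simp: balanced_def)
  \<comment> \<open>Step 5 only accepts the shape \<open>[0, a1, 0]\<close>: the outer entries of
    \<open>a\<close> vanish because the first and last heights bound them.\<close>
  have ends: "\<bar>a ! 0\<bar> \<le> height b 0" "\<bar>a ! 2\<bar> \<le> height b (length b)"
  proof -
    have "\<bar>a ! k\<bar> \<le> height b k \<and> \<bar>a ! k\<bar> \<le> height b (Suc k)" if "k < 3" for k
      using bal len that by (simp add: balanced_def)
    from this[of 0] this[of 2] show "\<bar>a ! 0\<bar> \<le> height b 0" "\<bar>a ! 2\<bar> \<le> height b (length b)"
      by (simp_all add: len)
  qed
  have "height b (length b) = 0" using bal by (simp add: balanced_def)
  with ends have a0: "a ! 0 = 0" "a ! 2 = 0" by auto
  have "a = [0, a ! 1, 0]" "b = [b ! 0, b ! 1, b ! 2]"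
    using a0 len by (auto simp: list_eq_iff_nth_eq numeral_3_eq_3 less_Suc_eq numeral_2_eq_2)
  then obtain a1 b0 b1 b2 where "a = [0, a1, 0]" "b = [b0, b1, b2]" by blast
  then show ?thesis unfolding Step5 using step5[OF refl] by blast
qed (use assms in auto)

lemma halts_invariant: "invariant n W c \<Longrightarrow> halts c"
proof (induction "config_rank c" arbitrary: c rule: less_induct)
  case less
  show ?case
  proof (cases "\<exists>N. c = Output N")
    case True
    then show ?thesis using halts_output by blast
  next
    case False
    then show ?thesis
      using less step_exists[of n W c] invariant_step[of c _ _ n W] by (intro halts_step) blast+
  qed
qed

text \<open>Each step costs at most \<open>n + 20\<close> and lowers the rank by at least 1, so the
  initial rank pays for the whole run; the gcd charge telescopes through
  \<open>pending_gcd\<close>.\<close>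

lemma run_invariant:
  assumes "run c t c'" "invariant n W c"
  shows "op_count g t \<le> (n + 20) * config_rank c + pending_gcd g c \<and>
    (\<forall>x\<in>operands t. \<bar>x\<bar> \<le> int n * W + 4 * W + int n + 3)"
  using assms
proof (induction rule: run.induct)
  case (run_refl c)
  then show ?case by simp
next
  case (run_step c t c' u c'')
  have inv: "invariant n W c'" and rank: "config_rank c' < config_rank c"
    using invariant_step run_step by blast+
  have "(n + 20) * Suc (config_rank c') \<le> (n + 20) * config_rank c"
    using rank by (intro mult_le_mono) auto
  then have "op_count g t + op_count g u \<le> (n + 20) * config_rank c + pending_gcd g c"
    using run_step(3)[OF inv] op_count_step[OF run_step(1,4), of g] by simp
  then show ?case
    using run_step(3)[OF inv] operands_step[OF run_step(1,4)] by auto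
qed

section \<open>Step 1: from raw coordinates to a balanced vector\<close>

lemma abs_prefix_le:
  fixes b :: "int list"
  shows "\<bar>sum_list (take k b)\<bar> \<le> sum_list (map abs b)"
    and "k < length b \<Longrightarrow> \<bar>b ! k\<bar> + sum_list (map abs (take k b)) \<le> sum_list (map abs b)"
proof -
  have split: "sum_list (map abs b) = sum_list (map abs (take k b)) + sum_list (map abs (drop k b))" for k
    by (metis append_take_drop_id map_append sum_list_append)
  have nonneg: "0 \<le> sum_list (map abs (drop k b))" for k
    by (rule sum_list_nonneg) auto
  show "\<bar>sum_list (take k b)\<bar> \<le> sum_list (map abs b)"
    using sum_list_abs[of "take k b"] split[of k] nonneg[of k] by linarith
  show "\<bar>b ! k\<bar> + sum_list (map abs (take k b)) \<le> sum_list (map abs b)" if "k < length b"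
    using that split[of "Suc k"] nonneg[of "Suc k"] by (simp add: take_Suc_conv_app_nth)
qed

text \<open>The prefix stops before \<open>b ! k\<close>, so no entry is counted twice and all
  values stay within a single \<open>M\<close>.\<close>

lemma peak_expr_bounds:
  assumes "k < length a" "length a = length b"
  defines "M \<equiv> sum_list (map abs a) + sum_list (map abs b)"
  shows "val (peak_expr a b (Suc k)) = \<bar>a ! k\<bar> + max (b ! k) 0 + sum_list (take k b)"
    and "\<bar>val (peak_expr a b (Suc k))\<bar> \<le> M"
    and "x \<in> operands (ops (peak_expr a b (Suc k))) \<Longrightarrow> \<bar>x\<bar> \<le> M"
    and "op_count g (ops (peak_expr a b (Suc k))) = k + 5"
proof -
  show v: "val (peak_expr a b (Suc k)) = \<bar>a ! k\<bar> + max (b ! k) 0 + sum_list (take k b)"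
    by (simp add: peak_expr_def AbsE_def PosE_def NegE_def abs_if max_def)
  define pa pb S where "pa = a ! k" and "pb = b ! k" and "S = sum_list (map abs (take k b))"
  have a: "\<bar>pa\<bar> \<le> sum_list (map abs a)"
    unfolding pa_def using assms by (intro member_le_sum_list) auto
  have b: "\<bar>pb\<bar> + S \<le> sum_list (map abs b)"
    unfolding pb_def S_def using abs_prefix_le(2) assms by simp
  have S: "\<bar>sum_list (take k b)\<bar> \<le> S" unfolding S_def by (rule sum_list_abs)
  have M: "\<bar>pa\<bar> + \<bar>pb\<bar> + S \<le> M" using a b unfolding M_def by linarith
  show "\<bar>val (peak_expr a b (Suc k))\<bar> \<le> M"
    using M S unfolding v pa_def[symmetric] pb_def[symmetric] by linarith
  show "\<bar>x\<bar> \<le> M" if "x \<in> operands (ops (peak_expr a b (Suc k)))"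
  proof -
    have "x \<in> operands (ops (SumE (take k b))) \<or>
        x \<in> {0, pa, - pa, pb, max pa (- pa), max pb 0} \<or>
        x \<in> {max pa (- pa) + max pb 0, sum_list (take k b)}"
      using that by (auto simp: peak_expr_def AbsE_def PosE_def NegE_def pa_def pb_def)
    moreover have "\<bar>x\<bar> \<le> S" if "x \<in> operands (ops (SumE (take k b)))"
      using operands_SumE[OF that] by (simp add: S_def)
    moreover have "\<bar>x\<bar> \<le> \<bar>pa\<bar> + \<bar>pb\<bar>" if "x \<in> {0, pa, - pa, pb, max pa (- pa), max pb 0}"
      using that by auto
    moreover have "\<bar>x\<bar> \<le> \<bar>pa\<bar> + \<bar>pb\<bar> + S" if "x \<in> {max pa (- pa) + max pb 0, sum_list (take k b)}"
      using that S by auto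
    ultimately show ?thesis using M S by linarith
  qed
  show "op_count g (ops (peak_expr a b (Suc k))) = k + 5"
    using assms by (simp add: peak_expr_def AbsE_def PosE_def NegE_def)
qed

lemma step1_analysis:
  assumes st: "step (Step1 a b) t c" and len: "length a = n - 2" "length b = n - 2" and n: "3 < n"
  defines "M \<equiv> sum_list (map abs a) + sum_list (map abs b)"
  shows "invariant n (2 * M) c" and "config_rank c \<le> 6 * n * nat M + n + 3"
    and "op_count g t \<le> n * (n + 5)" and "x \<in> operands t \<Longrightarrow> \<bar>x\<bar> \<le> 2 * M"
    and "pending_gcd g c = g"
proof -
  define es where "es = map (peak_expr a b) [1..<Suc (length a)]"
  define m where "m = val (MaximumE es)"
  obtain e f where e: "e = NegE (MaximumE es)" and f: "f = SubE (NegE (Lit (val e))) (SumE b)"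
    and t: "t = ops e @ ops f" and c: "c = Step2 (0 # a @ [0]) (val e # b @ [val f]) 0"
    using st unfolding es_def by (cases rule: step.cases) auto
  have leq: "length a = length b" using len by simp
  have es: "es \<noteq> []" "length es = n - 2" using len n by (auto simp: es_def)
  have set_es: "set es = peak_expr a b ` Suc ` {..<length a}"
    unfolding es_def by (simp add: image_Suc_lessThan atLeastLessThanSuc_atLeastAtMost del: upt_Suc)
  have es_bounds: "\<forall>e\<in>set es. \<bar>val e\<bar> \<le> M \<and> (\<forall>x\<in>operands (ops e). \<bar>x\<bar> \<le> M)"
    unfolding set_es M_def using peak_expr_bounds(2,3)[OF _ leq] by auto
  have mM: "\<bar>m\<bar> \<le> M" and ops_m: "\<And>x. x \<in> operands (ops (MaximumE es)) \<Longrightarrow> \<bar>x\<bar> \<le> M"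
    using operands_MaximumE[OF es(1) es_bounds] by (auto simp: m_def)
  \<comment> \<open>This encodes both inequalities for the shifted entry \<open>Suc k\<close>:
    subtracting \<open>max (b ! k) 0\<close> from \<open>m - sum_list (take k b)\<close> gives the
    smaller of its two heights. Thus \<open>m\<close> is the least value for which they all
    hold.\<close>
  have peak: "\<bar>a ! k\<bar> + max (b ! k) 0 + sum_list (take k b) \<le> m" if "k < length a" for k
  proof -
    have "val (peak_expr a b (Suc k)) \<le> m"
      unfolding m_def val_MaximumE[OF es(1)] using that by (intro Max_ge) (auto simp: set_es)
    then show ?thesis using peak_expr_bounds(1)[OF that leq] by simp
  qed
  have M: "0 \<le> M" using mM by linarith
  let ?a = "0 # a @ [0]" and ?b = "- m # b @ [m - sum_list b]"
  have val_e: "val e = - m" and val_f: "val f = m - sum_list b"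
    by (simp_all add: e f NegE_def m_def)
  have h: "height ?b (Suc k) = m - sum_list (take k b)" if "k \<le> length b" for k
    using that by (simp add: height_def)
  have h_end: "height ?b (length ?b) = 0" by (simp add: height_def)
  have prefix: "\<bar>sum_list (take k b)\<bar> \<le> M" for k
    using abs_prefix_le(1)[of k b] sum_list_nonneg[of "map abs a"] unfolding M_def by force
  have "\<bar>?a ! j\<bar> \<le> height ?b j \<and> \<bar>?a ! j\<bar> \<le> height ?b (Suc j) \<and> height ?b j \<le> 2 * M"
    if j: "j < length ?b" for j
  proof (cases j)
    case 0
    then show ?thesis using h[of 0] peak[of 0] M n len by simp
  next
    case (Suc k)
    show ?thesis
    proof (cases "k < length b")
      case True
      have "height ?b (Suc (Suc k)) = m - sum_list (take k b) - b ! k"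
        using h[of "Suc k"] True by (simp add: take_Suc_conv_app_nth)
      moreover have "?a ! j = a ! k" using Suc True leq by (simp add: nth_append)
      moreover have "\<bar>a ! k\<bar> \<le> m - sum_list (take k b)" "\<bar>a ! k\<bar> \<le> m - sum_list (take k b) - b ! k"
          "m - sum_list (take k b) \<le> 2 * M"
        using peak[OF True[folded leq]] prefix[of k] mM by linarith+
      ultimately show ?thesis using Suc h[of k] True by simp
    next
      case False
      then have k: "k = length b" using j Suc by simp
      have "length b \<noteq> 0" using len n by simp
      then obtain l where l: "length b = Suc l" using not0_implies_Suc by blast
      have "sum_list (take (Suc l) b) = sum_list (take l b) + b ! l"
        by (subst take_Suc_conv_app_nth) (simp_all add: l)
      \<comment> \<open>The height before the appended last entry is nonnegative by the last peak,
        since \<open>b ! l \<le> max (b ! l) 0\<close>.\<close>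
      then have "0 \<le> m - sum_list b" using peak[of l] leq l by simp
      moreover have "?a ! j = 0" using Suc k leq by (simp add: nth_append)
      ultimately show ?thesis
        using Suc k h[of k] h_end prefix[of k] mM by simp
    qed
  qed
  then have bal: "balanced (2 * M) ?a ?b"
    unfolding balanced_def using leq h_end by simp
  have lb: "length ?b = n" using len n by simp
  have pot: "potential ?b \<le> int n * (2 * M)" using potential_le[OF bal] unfolding lb .
  show "invariant n (2 * M) c"
    unfolding c val_e val_f using bal pot lb n by simp
  have "nat (potential ?b) \<le> nat (int n * (2 * M))" using pot by (rule nat_mono)
  also have "\<dots> = 2 * n * nat M" using M by (simp add: nat_mult_distrib)
  finally show "config_rank c \<le> 6 * n * nat M + n + 3"
    unfolding c val_e val_f using lb by simp
  have count: "\<forall>e\<in>set es. op_count g (ops e) \<le> n + 2"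
    unfolding set_es using peak_expr_bounds(4)[OF _ leq] len by auto
  have "op_count g (ops (MaximumE es)) \<le> (n - 2) * (n + 3)"
    using op_count_MaximumE[OF es(1) count] by (simp add: es(2) numeral_3_eq_3)
  moreover obtain k where "n = 2 + k" using n le_Suc_ex[of 2 n] by auto
  ultimately show "op_count g t \<le> n * (n + 5)"
    by (simp add: t e f NegE_def len algebra_simps)
  show "pending_gcd g c = g" by (simp add: c)
  show "\<bar>x\<bar> \<le> 2 * M" if "x \<in> operands t"
  proof -
    have "x \<in> operands (ops (MaximumE es)) \<or> x \<in> operands (ops (SumE b)) \<or>
        x \<in> {0, m, - m, sum_list b}"
      using that by (auto simp: t e f NegE_def m_def)
    moreover have "\<bar>x\<bar> \<le> M" if "x \<in> operands (ops (SumE b))"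
      using operands_SumE[OF that] sum_list_nonneg[of "map abs a"] unfolding M_def by force
    moreover have "\<bar>x\<bar> \<le> M" if "x \<in> {0, m, - m, sum_list b}"
      using that mM M prefix[of "length b"] by auto
    ultimately show ?thesis using ops_m[of x] M by linarith
  qed
qed

lemma step1_exists: "\<exists>t c. step (Step1 a b) t c"
  using step1[OF refl refl] by blast

section \<open>Bounds for the whole algorithm\<close>

lemma algorithm_bounds:
  assumes len: "length a = n - 2" "length b = n - 2" and n: "3 < n"
  defines "M \<equiv> sum_list (map abs a) + sum_list (map abs b)"
  shows "halts (Step1 a b)"
    and "run (Step1 a b) t (Output N) \<Longrightarrow>
      op_count g t \<le> n * (n + 5) + (n + 20) * (6 * n * nat M + n + 3) + g"
    and "\<lbrakk> run (Step1 a b) t (Output N); x \<in> operands t \<rbrakk> \<Longrightarrow>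
      \<bar>x\<bar> \<le> 2 * int n * M + 8 * M + int n + 3"
proof -
  note first = step1_analysis[OF _ len n, folded M_def]
  show "halts (Step1 a b)"
    using step1_exists halts_invariant[OF first(1)] by (intro halts_step) blast+
  assume "run (Step1 a b) t (Output N)"
  then obtain t1 t2 c where st: "step (Step1 a b) t1 c" and run: "run c t2 (Output N)" and t: "t = t1 @ t2"
    by (cases rule: run.cases) auto
  note rest = run_invariant[OF run first(1)[OF st]]
  have "(n + 20) * config_rank c \<le> (n + 20) * (6 * n * nat M + n + 3)"
    using first(2)[OF st] by (rule mult_le_mono2)
  then show "op_count g t \<le> n * (n + 5) + (n + 20) * (6 * n * nat M + n + 3) + g"
    using rest[of g, THEN conjunct1] first(3)[OF st, of g] first(5)[OF st, of g]
    unfolding t op_count_simps by linarith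
  have "0 \<le> M" unfolding M_def by (intro add_nonneg_nonneg sum_list_nonneg) auto
  then have "0 \<le> int n * M" by simp
  then show "\<bar>x\<bar> \<le> 2 * int n * M + 8 * M + int n + 3" if "x \<in> operands t"
  proof -
    have "\<bar>x\<bar> \<le> 2 * M \<or> \<bar>x\<bar> \<le> int n * (2 * M) + 4 * (2 * M) + int n + 3"
      using that first(4)[OF st, of x] rest[of g, THEN conjunct2] unfolding t operands_simps by blast
    moreover have "int n * (2 * M) = 2 * int n * M" by simp
    ultimately show ?thesis using \<open>0 \<le> M\<close> \<open>0 \<le> int n * M\<close> by linarith
  qed
qed

text \<open>\<open>\<kappa>\<close> is the constant in the assumed cost of the gcd, so
  \<open>C\<close> may depend on it; \<open>C\<close> and \<open>D\<close> are chosen before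
  \<open>n\<close> and the lamination.\<close>

theorem lemma10:
  fixes \<kappa> :: real
  shows "\<exists>C D :: real. \<forall>(n :: nat) (L :: complex set set) (a :: int list) (b :: int list) (M :: int) (g :: nat).
     n > 3 \<longrightarrow>
     L \<in> integral_laminations n \<longrightarrow>
     dynnikov_coordinates n L a b \<longrightarrow>
     (\<exists>x\<in>set a \<union> set b. x \<noteq> 0) \<longrightarrow>
     M = (\<Sum>i<n - 2. \<bar>a ! i\<bar> + \<bar>b ! i\<bar>) \<longrightarrow>
     real g \<le> \<kappa> * ln ((real n)\<^sup>2 * (real_of_int M)\<^sup>2) \<longrightarrow>
     halts (Step1 a b) \<and>
     (\<forall>t N. run (Step1 a b) t (Output N) \<longrightarrow>
        real (op_count g t) \<le> C * (real n)\<^sup>2 * real_of_int M \<and>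
        (\<forall>x\<in>operands t. real_of_int \<bar>x\<bar> \<le> D * (real n)\<^sup>2 * (real_of_int M)\<^sup>2))"
proof (intro exI allI impI)
  fix n L a b M g
  assume n: "3 < n" and coords: "dynnikov_coordinates n L a b"
    and nz: "\<exists>x\<in>set a \<union> set b. x \<noteq> (0 :: int)"
    and M: "M = (\<Sum>i<n - 2. \<bar>a ! i\<bar> + \<bar>b ! i\<bar>)"
    and g: "real g \<le> \<kappa> * ln ((real n)\<^sup>2 * (real_of_int M)\<^sup>2)"
  have len: "length a = n - 2" "length b = n - 2"
    using coords by (auto simp: dynnikov_coordinates_def)
  have M': "M = sum_list (map abs a) + sum_list (map abs b)"
    by (simp add: M sum_list_sum_nth len sum.distrib atLeast0LessThan)
  \<comment> \<open>This lets terms free of \<open>M\<close>, such as \<open>n^2\<close>, be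
    absorbed.\<close>
  have "1 \<le> M"
  proof -
    obtain x where x: "x \<in> set a \<union> set b" "x \<noteq> 0" using nz by blast
    have "0 \<le> sum_list (map abs a)" "0 \<le> sum_list (map abs b)"
      by (rule sum_list_nonneg; auto)+
    moreover have "\<bar>x\<bar> \<le> sum_list (map abs a) \<or> \<bar>x\<bar> \<le> sum_list (map abs b)"
      using x(1) by (auto intro!: member_le_sum_list)
    ultimately show ?thesis using x(2) unfolding M' by linarith
  qed
  define X Z where "X = real n" and "Z = real_of_int M"
  have X: "4 \<le> X" using n by (simp add: X_def)
  have Z: "1 \<le> Z" using \<open>1 \<le> M\<close> by (simp add: Z_def)
  have XZ: "X \<le> X * Z" "1 \<le> X * Z" "Z \<le> X * Z"
    using X Z mult_mono[of 1 X 1 Z] by (simp_all add: mult_le_cancel_left1 mult_le_cancel_right1)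
  have XXZ: "4 * (X * Z) \<le> X\<^sup>2 * Z" "X\<^sup>2 \<le> X\<^sup>2 * Z"
    using X Z by (simp_all add: power2_eq_square mult_right_mono mult_le_cancel_left1)
  have XXZZ: "X\<^sup>2 * Z \<le> X\<^sup>2 * Z\<^sup>2"
    using X Z by (simp add: power2_eq_square mult_le_cancel_left1)
  note bounds = algorithm_bounds[OF len n, folded M']
  \<comment> \<open>Taking the square out first matters: bounding the logarithm by
    \<open>X^2 * Z^2\<close> would lose a factor \<open>Z\<close>.\<close>
  have "ln (X\<^sup>2 * Z\<^sup>2) = 2 * ln (X * Z)"
    using X Z by (simp add: ln_realpow flip: power_mult_distrib)
  also have "\<dots> \<le> 2 * (X * Z)" using ln_bound[of "X * Z"] XZ by simp
  also have "\<dots> \<le> 2 * (X\<^sup>2 * Z)" using XXZ XZ by linarith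
  finally have "\<bar>\<kappa>\<bar> * ln (X\<^sup>2 * Z\<^sup>2) \<le> \<bar>\<kappa>\<bar> * (2 * (X\<^sup>2 * Z))" by (rule mult_left_mono) simp
  moreover have "0 \<le> ln (X\<^sup>2 * Z\<^sup>2)" using \<open>ln (X\<^sup>2 * Z\<^sup>2) = 2 * ln (X * Z)\<close> XZ by simp
  then have "\<kappa> * ln (X\<^sup>2 * Z\<^sup>2) \<le> \<bar>\<kappa>\<bar> * ln (X\<^sup>2 * Z\<^sup>2)" by (intro mult_right_mono) auto
  ultimately have gcd_cost: "real g \<le> 2 * \<bar>\<kappa>\<bar> * X\<^sup>2 * Z"
    using g by (simp add: X_def Z_def mult.assoc mult.left_commute)
  have real_nat: "real (nat M) = Z" using \<open>1 \<le> M\<close> by (simp add: Z_def)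
  \<comment> \<open>This fixes \<open>C = 60 + 2 * |\<kappa>|\<close> and \<open>D = 20\<close>.
    Both are generous; the estimates below would allow 51 in place of 60.\<close>
  show "halts (Step1 a b) \<and>
     (\<forall>t N. run (Step1 a b) t (Output N) \<longrightarrow>
        real (op_count g t) \<le> (60 + 2 * \<bar>\<kappa>\<bar>) * (real n)\<^sup>2 * real_of_int M \<and>
        (\<forall>x\<in>operands t. real_of_int \<bar>x\<bar> \<le> 20 * (real n)\<^sup>2 * (real_of_int M)\<^sup>2))"
  proof (intro conjI allI impI ballI bounds(1))
    fix t N
    assume run: "run (Step1 a b) t (Output N)"
    have "real (op_count g t) \<le> real (n * (n + 5) + (n + 20) * (6 * n * nat M + n + 3) + g)"
      using bounds(2)[OF run] by (rule of_nat_mono)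
    also have "\<dots> = X * (X + 5) + (X + 20) * (6 * (X * Z) + X + 3) + real g"
      by (simp add: X_def real_nat mult.assoc)
    also have "\<dots> \<le> X * (3 * X) + (6 * X) * (8 * (X * Z)) + 2 * \<bar>\<kappa>\<bar> * X\<^sup>2 * Z"
    proof -
      have "X + 5 \<le> 3 * X" "X + 20 \<le> 6 * X" "6 * (X * Z) + X + 3 \<le> 8 * (X * Z)" "0 \<le> X * Z"
        using X XZ by linarith+
      then show ?thesis using X gcd_cost by (intro add_mono mult_mono) linarith+
    qed
    also have "\<dots> \<le> (60 + 2 * \<bar>\<kappa>\<bar>) * X\<^sup>2 * Z"
      using XXZ X Z by (simp add: power2_eq_square algebra_simps)
    finally show "real (op_count g t) \<le> (60 + 2 * \<bar>\<kappa>\<bar>) * (real n)\<^sup>2 * real_of_int M"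
      by (simp add: X_def Z_def)
    fix x
    assume "x \<in> operands t"
    then have "real_of_int \<bar>x\<bar> \<le> real_of_int (2 * int n * M + 8 * M + int n + 3)"
      using bounds(3)[OF run] by (simp only: of_int_le_iff)
    also have "\<dots> = 2 * (X * Z) + 8 * Z + X + 3" by (simp add: X_def Z_def)
    also have "\<dots> \<le> 20 * (X\<^sup>2 * Z\<^sup>2)" using XZ XXZ XXZZ by linarith
    finally show "real_of_int \<bar>x\<bar> \<le> 20 * (real n)\<^sup>2 * (real_of_int M)\<^sup>2"
      by (simp add: X_def Z_def)
  qed
qed

end
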